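(* Work in the semifield $\mathbb{R}_{\max,+}$. Let $\bm{A},\bm{B}$ be $n\times n$ matrices and $\bm{g},\bm{h}$ be $n$-vectors over $\mathbb{R}_{\max,+}$, where $\bm{A}$ is column-regular with nonzero spectral radius and $\bm{h}$ is regular. Consider the problem of finding regular vectors $\bm{x}$ (together with vectors $\bm{y}$) that $$ \text{minimize}\quad \bm{x}^{-}\bm{y}\qquad\text{subject to}\quad \bm{B}\bm{x}\oplus\bm{g}\leq\bm{x},\quad \bm{A}\bm{x}=\bm{y},\quad \bm{h}\geq\bm{y}. $$ Define $\Delta=\mathrm{Tr}(\bm{B})\oplus\bm{h}^{-}\bm{A}\bm{B}^{\ast}\bm{g}$ and $$ \theta=\bigoplus_{k=1}^{n}\ \bigoplus_{0\leq i_{0}+i_{1}+\cdots+i_{k}\leq n-k}\mathrm{tr}^{1/k}\bigl(\bm{B}^{i_{0}}(\bm{A}\bm{B}^{i_{1}}\cdots\bm{A}\bm{B}^{i_{k}})(\bm{I}\oplus\bm{g}\bm{h}^{-}\bm{A})\bigr), $$ where the inner sum is over all nonnegative integers $i_0,\ldots,i_k$ satisfying the indicated inequality. Then: 1. If $\Delta\leq\mathbb{1}$, then $\theta$ is the minimum in the problem, and the general solution (i.e. the set of all minimizing pairs $(\bm{x},\bm{y})$ with $\bm{x}$ regular) is given by $$ \bm{x}=\bm{S}^{\ast}\bm{u},\qquad \bm{y}=\bm{A}\bm{S}^{\ast}\bm{u}, $$ where $\bm{S}=\theta^{-1}\bm{A}\oplus\bm{B}$ and $\bm{u}$ is any regular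 vector such that $\bm{g}\leq\bm{u}\leq(\bm{h}^{-}\bm{A}\bm{S}^{\ast})^{-}$. 2. If $\Delta>\mathbb{1}$, then there is no regular solution (no regular $\bm{x}$ satisfies the constraints).
   Context: $\mathbb{R}_{\max,+}=\langle\mathbb{R}\cup\{-\infty\},-\infty,0,\max,+\rangle$: addition $\oplus=\max$, multiplication $\otimes=+$ (sign omitted), zero $\mathbb{0}=-\infty$, identity $\mathbb{1}=0$, inverse $x^{-1}=-x$ for $x\in\mathbb{R}$, power $x^{1/k}=x/k$ in ordinary arithmetic (with $\mathbb{0}^{1/k}=\mathbb{0}$ for $k\geq1$), and the order is the natural one. Matrix addition, multiplication and scalar multiplication are defined by the usual formulas using $\oplus,\otimes$; inequalities between vectors are entrywise. $\bm{I}$ is the identity matrix ($\mathbb{1}$ on the diagonal, $\mathbb{0}$ elsewhere), $\bm{A}^0=\bm{I}$, $\bm{A}^p=\bm{A}^{p-1}\bm{A}$. A matrix is column-regular if no column consists entirely of $\mathbb{0}$; a vector is regular if all its components are different from $\mathbb{0}$. For a nonzero column (resp. row) vector $\bm{x}=(x_i)$, the multiplicative conjugate transpose $\bm{x}^{-}$ is the row (resp. column) vector with entries $x_i^{-1}$ if $x_i>\mathbb{0}$ and $\mathbb{0}$ otherwise. For an $n\times n$ matrix $\bm{A}=(a_{ij})$: $\mathrm{tr}\,\bm{A}=a_{11}\oplus\cdots\oplus a_{nn}$, and $\mathrm{tr}^{1/k}(\bm{A})$ denotes $(\mathrm{tr}\,\bm{A})^{1/k}$; $\mathrm{Tr}(\bm{A})=\mathrm{tr}\,\bm{A}\oplus\mathrm{tr}\,\bm{A}^2\oplus\cdots\oplus\mathrm{tr}\,\bm{A}^{n}$;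 $\bm{A}^{\ast}=\bm{I}\oplus\bm{A}\oplus\cdots\oplus\bm{A}^{n-1}$; the spectral radius of $\bm{A}$ is $\lambda=\mathrm{tr}\,\bm{A}\oplus\mathrm{tr}^{1/2}(\bm{A}^2)\oplus\cdots\oplus\mathrm{tr}^{1/n}(\bm{A}^{n})$ (the maximum eigenvalue of $\bm{A}$). *)

theory Defs
  imports "HOL-Analysis.Determinants"
begin

section \<open>The semifield of extended reals under maximum and addition\<close>

datatype maxplus = MInf | Fin real

text \<open>The class operations are the semifield ones: the order is the natural one with
  \<^term>\<open>MInf\<close> as least element, \<open>+\<close> is the maximum, \<open>*\<close> is ordinary addition, \<open>0\<close> is
  \<^term>\<open>MInf\<close> and \<open>1\<close> is \<^term>\<open>Fin 0\<close>. Sums \<open>\<Sum>\<close> are therefore maxima, and \<open>trace\<close>,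
  \<open>mat 1\<close>, \<open>**\<close>, \<open>*v\<close>, \<open>v*\<close> have their max-plus meaning.\<close>

instantiation maxplus :: linorder
begin
fun less_eq_maxplus :: "maxplus \<Rightarrow> maxplus \<Rightarrow> bool" where
  "MInf \<le> y \<longleftrightarrow> True"
| "Fin a \<le> MInf \<longleftrightarrow> False"
| "Fin a \<le> Fin b \<longleftrightarrow> a \<le> b"
definition less_maxplus :: "maxplus \<Rightarrow> maxplus \<Rightarrow> bool" where
  "x < y \<longleftrightarrow> \<not> y \<le> (x :: maxplus)"
instance
proof
  fix x y z :: maxplus
  show "x < y \<longleftrightarrow> x \<le> y \<and> \<not> y \<le> x"
    by (cases x; cases y) (auto simp: less_maxplus_def)
  show "x \<le> x" by (cases x) auto
  show "x \<le> y \<Longrightarrow> y \<le> z \<Longrightarrow> x \<le> z" by (cases x; cases y; cases z) auto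
  show "x \<le> y \<Longrightarrow> y \<le> x \<Longrightarrow> x = y" by (cases x; cases y) auto
  show "x \<le> y \<or> y \<le> x" by (cases x; cases y) auto
qed
end

instantiation maxplus :: comm_semiring_1
begin
definition zero_maxplus :: maxplus where "0 = MInf"
definition one_maxplus :: maxplus where "1 = Fin 0"
definition plus_maxplus :: "maxplus \<Rightarrow> maxplus \<Rightarrow> maxplus" where "x + y = max x (y :: maxplus)"
fun times_maxplus :: "maxplus \<Rightarrow> maxplus \<Rightarrow> maxplus" where
  "MInf * y = MInf"
| "Fin a * MInf = MInf"
| "Fin a * Fin b = Fin (a + b)"
instance
proof
  fix a b c :: maxplus
  show "a * b * c = a * (b * c)" by (cases a; cases b; cases c) auto
  show "a * b = b * a" by (cases a; cases b) auto
  show "1 * a = a" by (cases a) (auto simp: one_maxplus_def)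
  show "a + b + c = a + (b + c)" by (simp add: plus_maxplus_def max.assoc)
  show "a + b = b + a" by (simp add: plus_maxplus_def max.commute)
  show "0 + a = a" by (cases a) (auto simp: zero_maxplus_def plus_maxplus_def max_def)
  show "0 * a = 0" "a * 0 = 0" by (cases a; auto simp: zero_maxplus_def)+
  show "(a + b) * c = a * c + b * c"
    by (cases a; cases b; cases c) (auto simp: plus_maxplus_def max_def)
  show "(0 :: maxplus) \<noteq> 1" by (simp add: zero_maxplus_def one_maxplus_def)
qed
end

instance maxplus :: canonically_ordered_monoid_add
proof
  fix a b :: maxplus
  show "a \<le> b \<longleftrightarrow> (\<exists>c. b = a + c)"
    by (metis plus_maxplus_def max.cobounded1 max_absorb2)
qed

instance maxplus :: ordered_comm_semiring
proof
  fix a b c :: maxplus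
  show "a \<le> b \<Longrightarrow> 0 \<le> c \<Longrightarrow> c * a \<le> c * b" by (cases a; cases b; cases c) auto
qed

text \<open>The inverse of \<open>0\<close> is set to \<open>0\<close>, which is the convention of the conjugate transpose.\<close>

instantiation maxplus :: inverse
begin
fun inverse_maxplus :: "maxplus \<Rightarrow> maxplus" where
  "inverse MInf = MInf"
| "inverse (Fin a) = Fin (- a)"
definition divide_maxplus :: "maxplus \<Rightarrow> maxplus \<Rightarrow> maxplus" where
  "x div y = x * inverse (y :: maxplus)"
instance ..
end

fun mp_root :: "nat \<Rightarrow> maxplus \<Rightarrow> maxplus" where
  "mp_root k MInf = MInf"
| "mp_root k (Fin a) = Fin (a / real k)"

lemma mp_inverse_right: "x \<noteq> 0 \<Longrightarrow> x * inverse x = (1 :: maxplus)"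
  by (cases x) (auto simp: zero_maxplus_def one_maxplus_def)

lemma mp_power_Fin: "Fin a ^ k = Fin (real k * a)"
  by (induction k) (auto simp: one_maxplus_def algebra_simps)

lemma mp_root_0: "mp_root k 0 = 0"
  by (simp add: zero_maxplus_def)

lemma mp_root_power: "k \<ge> 1 \<Longrightarrow> mp_root k x ^ k = x"
  by (cases x) (auto simp: mp_power_Fin mp_root_0 power_0_left simp flip: zero_maxplus_def)


section \<open>Vectors and matrices\<close>

text \<open>Row and column vectors share the type \<^typ>\<open>maxplus ^ 'n\<close>.\<close>

definition regular :: "maxplus ^ 'n \<Rightarrow> bool" where
  "regular x \<longleftrightarrow> (\<forall>i. x $ i \<noteq> 0)"

definition column_regular :: "maxplus ^ 'n ^ 'm \<Rightarrow> bool" where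
  "column_regular A \<longleftrightarrow> (\<forall>j. \<exists>i. A $ i $ j \<noteq> 0)"

definition conj_transpose :: "maxplus ^ 'n \<Rightarrow> maxplus ^ 'n" where
  "conj_transpose x = (\<chi> i. inverse (x $ i))"

text \<open>Row vector times column vector, and column vector times row vector.\<close>

definition row_col :: "maxplus ^ 'n \<Rightarrow> maxplus ^ 'n \<Rightarrow> maxplus" where
  "row_col r x = (\<Sum>i\<in>UNIV. r $ i * x $ i)"

definition col_row :: "maxplus ^ 'm \<Rightarrow> maxplus ^ 'n \<Rightarrow> maxplus ^ 'n ^ 'm" where
  "col_row x r = (\<chi> i j. x $ i * r $ j)"

definition mat_scale :: "maxplus \<Rightarrow> maxplus ^ 'n ^ 'm \<Rightarrow> maxplus ^ 'n ^ 'm" where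
  "mat_scale c A = (\<chi> i j. c * A $ i $ j)"

primrec matpow :: "maxplus ^ 'n ^ 'n \<Rightarrow> nat \<Rightarrow> maxplus ^ 'n ^ 'n" where
  "matpow A 0 = mat 1"
| "matpow A (Suc p) = matpow A p ** A"

definition Tr :: "maxplus ^ 'n ^ 'n \<Rightarrow> maxplus" where
  "Tr A = (\<Sum>k = 1..CARD('n). trace (matpow A k))"

definition star :: "maxplus ^ 'n ^ 'n \<Rightarrow> maxplus ^ 'n ^ 'n" where
  "star A = (\<Sum>k < CARD('n). matpow A k)"

definition mp_spectral_radius :: "maxplus ^ 'n ^ 'n \<Rightarrow> maxplus" where
  "mp_spectral_radius A = (\<Sum>k = 1..CARD('n). mp_root k (trace (matpow A k)))"


section \<open>The optimization problem\<close>

definition feasible ::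
  "maxplus ^ 'n ^ 'n \<Rightarrow> maxplus ^ 'n ^ 'n \<Rightarrow> maxplus ^ 'n \<Rightarrow> maxplus ^ 'n
    \<Rightarrow> (maxplus ^ 'n) \<times> (maxplus ^ 'n) \<Rightarrow> bool" where
  "feasible A B g h = (\<lambda>(x, y). regular x \<and> B *v x + g \<le> x \<and> A *v x = y \<and> h \<ge> y)"

definition objective :: "(maxplus ^ 'n) \<times> (maxplus ^ 'n) \<Rightarrow> maxplus" where
  "objective = (\<lambda>(x, y). row_col (conj_transpose x) y)"

definition Delta ::
  "maxplus ^ 'n ^ 'n \<Rightarrow> maxplus ^ 'n ^ 'n \<Rightarrow> maxplus ^ 'n \<Rightarrow> maxplus ^ 'n \<Rightarrow> maxplus" where
  "Delta A B g h = Tr B + row_col (conj_transpose h v* A v* star B) g"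

text \<open>For \<open>js = [i\<^sub>1, \<dots>, i\<^sub>k]\<close> this is the product \<open>A B\<^bsup>i\<^sub>1\<^esup> \<cdots> A B\<^bsup>i\<^sub>k\<^esup>\<close>.\<close>

definition word_prod ::
  "maxplus ^ 'n ^ 'n \<Rightarrow> maxplus ^ 'n ^ 'n \<Rightarrow> nat list \<Rightarrow> maxplus ^ 'n ^ 'n" where
  "word_prod A B js = foldr (\<lambda>i M. A ** matpow B i ** M) js (mat 1)"

definition exponents :: "nat \<Rightarrow> nat \<Rightarrow> (nat \<times> nat list) set" where
  "exponents k m = {(i0, js). length js = k \<and> i0 + sum_list js \<le> m}"

text \<open>Since \<open>\<Sum>\<close> over an infinite set would be \<open>0\<close>, finiteness matters for \<open>theta\<close> below.\<close>

lemma finite_exponents: "finite (exponents k m)"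
proof (rule finite_subset)
  show "exponents k m \<subseteq> {..m} \<times> {js. set js \<subseteq> {..m} \<and> length js = k}"
    by (auto simp: exponents_def dest: member_le_sum_list)
  show "finite ({..m} \<times> {js. set js \<subseteq> {..m} \<and> length js = k})"
    by (intro finite_cartesian_product finite_lists_length_eq) auto
qed

definition theta ::
  "maxplus ^ 'n ^ 'n \<Rightarrow> maxplus ^ 'n ^ 'n \<Rightarrow> maxplus ^ 'n \<Rightarrow> maxplus ^ 'n \<Rightarrow> maxplus" where
  "theta A B g h =
     (\<Sum>k = 1..CARD('n). \<Sum>(i0, js) \<in> exponents k (CARD('n) - k).
        mp_root k (trace (matpow B i0 ** word_prod A B js
                          ** (mat 1 + col_row g (conj_transpose h) ** A))))"

end

theory Submission
  imports Defs
begin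

text \<open>For regular \<open>x\<close> and \<open>\<mu> > \<zero>\<close>, the bound \<open>x\<^sup>- A x \<le> \<mu>\<close> is the linear inequality \<open>\<mu>\<^sup>-\<^sup>1 A x \<le> x\<close>, so
  the constraints together with it read \<open>S\<^sub>\<mu> x \<oplus> g \<le> x\<close>, \<open>A x \<le> h\<close> with \<open>S\<^sub>\<mu> = \<mu>\<^sup>-\<^sup>1 A \<oplus> B\<close>. When
  \<open>Tr S\<^sub>\<mu> \<le> \<one>\<close>, their regular solutions are \<open>x = S\<^sub>\<mu>\<^sup>* u\<close> with \<open>g \<le> u \<le> (h\<^sup>- A S\<^sub>\<mu>\<^sup>*)\<^sup>-\<close>, and such
  \<open>u\<close> exist iff \<open>h\<^sup>- A S\<^sub>\<mu>\<^sup>* g \<le> \<one>\<close>. Expanding powers of \<open>S\<^sub>\<mu>\<close> into words in \<open>A\<close> and \<open>B\<close>, the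
  words without \<open>A\<close> give \<open>\<Delta> \<le> \<one>\<close>, the others \<open>\<theta> \<le> \<mu>\<close>. Necessity needs no expansion: \<open>x\<close> is a
  subeigenvector of \<open>A\<close>, of \<open>B\<close> and of \<open>I \<oplus> g h\<^sup>- A\<close>, hence of every word.\<close>

section \<open>Max-plus arithmetic\<close>

lemma mp_sum_le_iff:
  fixes f :: "'b \<Rightarrow> maxplus"
  assumes "finite I"
  shows "sum f I \<le> c \<longleftrightarrow> (\<forall>i\<in>I. f i \<le> c)"
  using assms by (induction I) (auto simp: plus_maxplus_def)

lemma mp_le_sum:
  fixes f :: "'b \<Rightarrow> maxplus"
  assumes "finite I" "i \<in> I"
  shows "f i \<le> sum f I"
  using mp_sum_le_iff[OF assms(1), of f "sum f I"] assms(2) by blast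

lemma mp_sum_attained:
  fixes f :: "'b \<Rightarrow> maxplus"
  assumes "finite I" "I \<noteq> {}"
  shows "\<exists>i\<in>I. sum f I = f i"
  using assms
proof (induction I rule: finite_ne_induct)
  case (insert a I)
  then show ?case by (auto simp: plus_maxplus_def max_def)
qed simp

lemma mp_add_le_iff: "a + b \<le> c \<longleftrightarrow> a \<le> c \<and> b \<le> (c :: maxplus)"
  by (simp add: plus_maxplus_def)

lemma mp_le_add: "a \<le> a + b" "b \<le> a + (b :: maxplus)"
  by (simp_all add: plus_maxplus_def)

lemma mp_mult_mono: "a \<le> b \<Longrightarrow> c \<le> d \<Longrightarrow> a * c \<le> b * (d :: maxplus)"
  by (simp add: mult_mono)

lemma mp_mult_right_le_cancel: "x \<noteq> 0 \<Longrightarrow> a * x \<le> b * x \<longleftrightarrow> a \<le> (b :: maxplus)"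
  by (cases x; cases a; cases b) (auto simp: zero_maxplus_def)

lemma mp_mult_eq_0_iff: "a * b = 0 \<longleftrightarrow> a = 0 \<or> b = (0 :: maxplus)"
  by (cases a; cases b) (auto simp: zero_maxplus_def)

lemma mp_inverse_eq_0_iff: "inverse a = 0 \<longleftrightarrow> a = (0 :: maxplus)"
  by (cases a) (auto simp: zero_maxplus_def)

lemma mp_inverse_mult_le_iff: "x \<noteq> 0 \<Longrightarrow> inverse x * a \<le> b \<longleftrightarrow> a \<le> b * (x :: maxplus)"
  by (cases x; cases a; cases b) (auto simp: zero_maxplus_def)

lemma mp_le_inverse_iff: "c \<noteq> 0 \<Longrightarrow> a \<le> inverse c \<longleftrightarrow> c * a \<le> (1 :: maxplus)"
  by (cases c; cases a) (auto simp: zero_maxplus_def one_maxplus_def)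

text \<open>Trades bounds on roots for bounds on powers, so that \<open>theta\<close> can be
  compared with \<open>c\<close> root-free.\<close>

lemma mp_root_le_iff: "k \<ge> 1 \<Longrightarrow> mp_root k a \<le> b \<longleftrightarrow> a \<le> b ^ k"
proof (cases a; cases b)
  fix x assume "k \<ge> 1" "a = Fin x" "b = MInf"
  then show ?thesis
    by (cases k) auto
qed (auto simp: mp_power_Fin field_simps)

lemma mp_inverse_power_mult_le:
  fixes a x :: maxplus
  assumes "x \<noteq> 0" "a \<le> x ^ k"
  shows "inverse x ^ k * a \<le> 1"
proof -
  have "inverse x ^ k * a \<le> (inverse x * x) ^ k"
    unfolding power_mult_distrib using assms by (intro mp_mult_mono) auto
  also have "\<dots> = 1"
    using mp_inverse_right[OF assms(1)] by (simp add: mult.commute)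
  finally show ?thesis .
qed


section \<open>Matrices and vectors\<close>

lemma mat_vec_le_iff:
  fixes M :: "maxplus ^ 'n ^ 'm"
  shows "M *v x \<le> y \<longleftrightarrow> (\<forall>i j. M $ i $ j * x $ j \<le> y $ i)"
  by (auto simp: less_eq_vec_def matrix_vector_mult_def mp_sum_le_iff)

lemma mat_vec_entry_le:
  fixes M :: "maxplus ^ 'n ^ 'm"
  shows "M $ i $ j * x $ j \<le> (M *v x) $ i"
  using mat_vec_le_iff[of M x "M *v x"] by simp

lemma mat_vec_mono:
  fixes M N :: "maxplus ^ 'n ^ 'm"
  assumes "M \<le> N" "x \<le> y"
  shows "M *v x \<le> N *v y"
  using assms unfolding less_eq_vec_def matrix_vector_mult_def
  by (auto intro!: sum_mono mp_mult_mono)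

lemma mat_mult_entry_le:
  fixes M :: "maxplus ^ 'n ^ 'm" and N :: "maxplus ^ 'k ^ 'n"
  shows "M $ i $ l * N $ l $ j \<le> (M ** N) $ i $ j"
  unfolding matrix_matrix_mult_def by (auto intro: mp_le_sum)

text \<open>A sum over the nonempty index type is a maximum, hence attained; an entry of a product
  can thus be followed along a single path.\<close>

lemma mat_mult_attained:
  fixes M :: "maxplus ^ 'n ^ 'm" and N :: "maxplus ^ 'k ^ 'n"
  shows "\<exists>l. (M ** N) $ i $ j = M $ i $ l * N $ l $ j"
  unfolding matrix_matrix_mult_def using mp_sum_attained[of "UNIV :: 'n set"] by auto

lemma mat_vec_scale: "(M :: maxplus ^ 'n ^ 'm) *v (c *s x) = c *s (M *v x)"
  by (simp add: vec_eq_iff matrix_vector_mult_def sum_distrib_left mult_ac)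

lemma mat_scale_vec: "mat_scale c M *v x = c *s (M *v x)"
  by (simp add: vec_eq_iff matrix_vector_mult_def mat_scale_def sum_distrib_left mult_ac)

lemma vec_scale_mono: "x \<le> y \<Longrightarrow> c *s x \<le> c *s (y :: maxplus ^ 'n)"
  by (simp add: less_eq_vec_def mult_left_mono)

lemma vec_add_le_iff: "x + y \<le> z \<longleftrightarrow> x \<le> z \<and> y \<le> (z :: maxplus ^ 'n)"
  by (auto simp: less_eq_vec_def mp_add_le_iff)

section \<open>Residuation: scalar bounds as vector inequalities\<close>

lemma row_col_le_iff: "row_col r x \<le> c \<longleftrightarrow> (\<forall>i. r $ i * x $ i \<le> c)"
  by (simp add: row_col_def mp_sum_le_iff)

lemma row_col_vec_mat: "row_col (r v* M) x = row_col r (M *v x)"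
proof -
  have "row_col (r v* M) x = (\<Sum>j\<in>UNIV. \<Sum>i\<in>UNIV. r $ i * M $ i $ j * x $ j)"
    by (simp add: row_col_def vector_matrix_mult_def sum_distrib_right)
  also have "\<dots> = (\<Sum>i\<in>UNIV. \<Sum>j\<in>UNIV. r $ i * M $ i $ j * x $ j)"
    by (rule sum.swap)
  also have "\<dots> = row_col r (M *v x)"
    by (simp add: row_col_def matrix_vector_mult_def sum_distrib_left mult.assoc)
  finally show ?thesis .
qed

text \<open>For regular \<open>x\<close> each \<open>inverse (x $ i)\<close> is a true inverse and
  moves across. This linearizes the objective and, with \<open>h\<close> for \<open>x\<close> and
  \<open>c = 1\<close>, encodes \<open>y \<le> h\<close>.\<close>

lemma row_col_conj_transpose_le_iff:
  assumes "regular x"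
  shows "row_col (conj_transpose x) y \<le> c \<longleftrightarrow> y \<le> c *s x"
  using assms
  by (auto simp: row_col_le_iff conj_transpose_def regular_def less_eq_vec_def
      mp_inverse_mult_le_iff)

text \<open>Regularity matters: at \<open>c $ i = 0\<close> the convention for
  \<open>inverse\<close> forces \<open>x $ i = 0\<close>, while the right-hand side leaves
  \<open>x $ i\<close> free.\<close>

lemma le_conj_transpose_iff:
  assumes "regular c"
  shows "x \<le> conj_transpose c \<longleftrightarrow> row_col c x \<le> 1"
  using assms
  by (auto simp: row_col_le_iff conj_transpose_def regular_def less_eq_vec_def
      mp_le_inverse_iff)

lemma regular_conj_transpose: "regular x \<Longrightarrow> regular (conj_transpose x)"
  by (simp add: regular_def conj_transpose_def mp_inverse_eq_0_iff)

lemma regular_mono: "regular x \<Longrightarrow> x \<le> y \<Longrightarrow> regular y"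
  unfolding regular_def less_eq_vec_def by (metis le_zero_eq)

text \<open>A nonzero entry in column \<open>j\<close> gives a nonzero term, and a maximum dominates
  its terms. Column-regularity of \<open>A\<close> enters the argument here.\<close>

lemma regular_vec_mat:
  fixes r :: "maxplus ^ 'm"
  assumes "regular r" "column_regular M"
  shows "regular (r v* M)"
  unfolding regular_def
proof
  fix j
  obtain i where "M $ i $ j \<noteq> 0"
    using assms(2) by (auto simp: column_regular_def)
  then have "M $ i $ j * r $ i \<noteq> 0"
    using assms(1) by (simp add: mp_mult_eq_0_iff regular_def)
  moreover have "M $ i $ j * r $ i \<le> (r v* M) $ j"
    unfolding vector_matrix_mult_def
    by (auto simp: mult.commute intro: mp_le_sum[where f = "\<lambda>i. r $ i * M $ i $ j"])
  ultimately show "(r v* M) $ j \<noteq> 0"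
    by auto
qed

text \<open>Only the diagonal term of each row is kept; the nonzero \<open>x $ i\<close> then
  cancels.\<close>

lemma trace_le_of_subeigenvector:
  fixes M :: "maxplus ^ 'n ^ 'n"
  assumes "regular x" "M *v x \<le> c *s x"
  shows "trace M \<le> c"
proof -
  have "M $ i $ i * x $ i \<le> c * x $ i" for i
    using assms(2) by (simp add: mat_vec_le_iff)
  then show ?thesis
    using assms(1) by (simp add: trace_def mp_sum_le_iff regular_def mp_mult_right_le_cancel)
qed

lemma col_row_vec: "col_row g r *v x = row_col r x *s g"
  by (simp add: vec_eq_iff col_row_def row_col_def matrix_vector_mult_def sum_distrib_left mult_ac)

lemma trace_le_iff: "trace (M :: maxplus ^ 'n ^ 'n) \<le> c \<longleftrightarrow> (\<forall>i. M $ i $ i \<le> c)"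
  by (simp add: trace_def mp_sum_le_iff)

lemma diag_le_trace: "M $ i $ i \<le> trace (M :: maxplus ^ 'n ^ 'n)"
  using trace_le_iff[of M "trace M"] by simp


section \<open>Powers and the Kleene star\<close>

lemma matpow_Suc_left: "matpow S (Suc k) = S ** matpow S k"
  proof (induction k)
  case (Suc k)
  have "matpow S (Suc (Suc k)) = (S ** matpow S k) ** S"
    using Suc by simp
  then show ?case by (simp add: matrix_mul_assoc)
qed simp

lemma matpow_add: "matpow S (a + b) = matpow S a ** matpow S b"
  by (induction b) (simp_all add: matrix_mul_assoc)

lemma matpow_vec_le:
  assumes "S *v x \<le> x"
  shows "matpow S k *v x \<le> x"
proof (induction k)
  case (Suc k)
  have "matpow S (Suc k) *v x = matpow S k *v (S *v x)"
    by (simp add: matrix_vector_mul_assoc)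
  also have "\<dots> \<le> matpow S k *v x"
    using assms by (intro mat_vec_mono) auto
  finally show ?case
    using Suc by (rule order_trans)
qed simp

lemma star_entry: "star (S :: maxplus ^ 'n ^ 'n) $ i $ j = (\<Sum>k<CARD('n). matpow S k $ i $ j)"
  by (simp add: star_def)

lemma matpow_le_star: "k < CARD('n) \<Longrightarrow> matpow (S :: maxplus ^ 'n ^ 'n) k $ i $ j \<le> star S $ i $ j"
  unfolding star_entry by (rule mp_le_sum[where f = "\<lambda>k. matpow S k $ i $ j"]) auto

lemma star_attained:
  fixes S :: "maxplus ^ 'n ^ 'n"
  shows "\<exists>k<CARD('n). star S $ i $ j = matpow S k $ i $ j"
  unfolding star_entry using mp_sum_attained[of "{..<CARD('n)}"] by fastforce

lemma star_vec_ge: "x \<le> star S *v x"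
proof -
  have "mat 1 \<le> star S"
    using matpow_le_star[of 0 S] by (simp add: less_eq_vec_def)
  then have "mat 1 *v x \<le> star S *v x"
    by (intro mat_vec_mono) auto
  then show ?thesis by simp
qed

lemma column_regular_star: "column_regular (star S)"
  unfolding column_regular_def
proof
  fix j
  have "mat 1 $ j $ j \<le> star S $ j $ j"
    using matpow_le_star[of 0 S j j] by simp
  then show "\<exists>i. star S $ i $ j \<noteq> 0"
    by (intro exI[of _ j]) (auto simp: mat_def)
qed

lemma star_vec_le:
  assumes "S *v x \<le> x"
  shows "star S *v x \<le> x"
  unfolding mat_vec_le_iff
proof (intro allI)
  fix i j
  obtain k where "star S $ i $ j = matpow S k $ i $ j"
    using star_attained by blast
  then show "star S $ i $ j * x $ j \<le> x $ i"
    using matpow_vec_le[OF assms, of k] by (simp add: mat_vec_le_iff)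
qed

lemma trace_matpow_le_Tr:
  fixes S :: "maxplus ^ 'n ^ 'n"
  assumes "1 \<le> k" "k \<le> CARD('n)"
  shows "trace (matpow S k) \<le> Tr S"
  unfolding Tr_def using assms by (intro mp_le_sum[where f = "\<lambda>k. trace (matpow S k)"]) auto

lemma Tr_le_1_of_subeigenvector:
  assumes "regular x" "S *v x \<le> x"
  shows "Tr S \<le> 1"
  using matpow_vec_le[OF assms(2)] trace_le_of_subeigenvector[OF assms(1), of _ 1]
  by (simp add: Tr_def mp_sum_le_iff)

section \<open>Walks in the weighted digraph of \<open>S\<close>\<close>

lemma walk_weight_le_matpow:
  fixes S :: "maxplus ^ 'n ^ 'n"
  shows "(\<Prod>t=a..<a + m. S $ v t $ v (Suc t)) \<le> matpow S m $ v a $ v (a + m)"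
proof (induction m)
  case 0
  then show ?case by (simp add: mat_def)
next
  case (Suc m)
  have "(\<Prod>t=a..<a + Suc m. S $ v t $ v (Suc t))
      \<le> matpow S m $ v a $ v (a + m) * S $ v (a + m) $ v (Suc (a + m))"
    using Suc by (simp add: mp_mult_mono)
  also have "\<dots> \<le> matpow S (Suc m) $ v a $ v (a + Suc m)"
    by (simp add: mat_mult_entry_le)
  finally show ?case .
qed

text \<open>Choosing a maximizing index at every step yields a best walk. The entry must be nonzero:
  for \<open>m = 0\<close> and \<open>i \<noteq> j\<close> no \<open>v\<close> meets both end
  conditions.\<close>

lemma matpow_attained_by_walk:
  fixes S :: "maxplus ^ 'n ^ 'n"
  assumes "matpow S m $ i $ j \<noteq> 0"
  shows "\<exists>v. v 0 = i \<and> v m = j \<and> matpow S m $ i $ j = (\<Prod>t<m. S $ v t $ v (Suc t))"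
  using assms
proof (induction m arbitrary: j)
  case 0
  then show ?case
    by (intro exI[of _ "\<lambda>_. i"]) (auto simp: mat_def split: if_splits)
next
  case (Suc m)
  obtain l where l: "matpow S (Suc m) $ i $ j = matpow S m $ i $ l * S $ l $ j"
    using mat_mult_attained[of "matpow S m" S i j] by auto
  then obtain v where v: "v 0 = i" "v m = l"
      "matpow S m $ i $ l = (\<Prod>t<m. S $ v t $ v (Suc t))"
    using Suc by (metis mult_zero_left)
  have "(\<Prod>t<m. S $ (v(Suc m := j)) t $ (v(Suc m := j)) (Suc t)) = (\<Prod>t<m. S $ v t $ v (Suc t))"
    by (intro prod.cong) auto
  then show ?case
    using v l by (intro exI[of _ "v(Suc m := j)"]) simp
qed

text \<open>A walk with as many steps as there are vertices repeats a vertex; removing the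
  resulting cycle, whose weight is at most 1, does not decrease the weight of the walk.\<close>

lemma matpow_card_le_star:
  fixes S :: "maxplus ^ 'n ^ 'n"
  assumes "Tr S \<le> 1"
  shows "matpow S CARD('n) $ i $ j \<le> star S $ i $ j"
proof (cases "matpow S CARD('n) $ i $ j = 0")
  case False
  define n where "n = CARD('n)"
  define w where "w t v = S $ v t $ v (Suc t)" for t and v :: "nat \<Rightarrow> 'n"
  obtain v where v: "v 0 = i" "v n = j" "matpow S n $ i $ j = (\<Prod>t<n. w t v)"
    using matpow_attained_by_walk[OF False] unfolding n_def w_def by blast
  have "\<not> inj_on v {..n}"
  proof
    assume "inj_on v {..n}"
    then have "card {..n} \<le> CARD('n)"
      by (rule card_inj_on_le) auto
    then show False by (simp add: n_def)
  qed
  then obtain a b where ab: "a < b" "b \<le> n" "v a = v b"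
    unfolding inj_on_def by (metis atMost_iff linorder_neqE_nat)
  have "(\<Prod>t<n. w t v) = (\<Prod>t=0..<a. w t v) * (\<Prod>t=a..<b. w t v) * (\<Prod>t=b..<n. w t v)"
    using ab by (simp add: prod.atLeastLessThan_concat lessThan_atLeast0)
  also have "\<dots> \<le> matpow S a $ i $ v a * 1 * matpow S (n - b) $ v a $ j"
  proof (intro mp_mult_mono)
    show "(\<Prod>t=0..<a. w t v) \<le> matpow S a $ i $ v a"
      using walk_weight_le_matpow[where S = S and v = v and a = 0 and m = a] v by (simp add: w_def)
    show "(\<Prod>t=b..<n. w t v) \<le> matpow S (n - b) $ v a $ j"
      using walk_weight_le_matpow[where S = S and v = v and a = b and m = "n - b"] v ab by (simp add: w_def)
    \<comment> \<open>The middle segment is closed since \<open>v a = v b\<close>, and its length is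
      between 1 and \<open>n\<close>, so \<open>Tr S\<close> covers it.\<close>
    have "(\<Prod>t=a..<b. w t v) \<le> matpow S (b - a) $ v a $ v a"
      using walk_weight_le_matpow[where S = S and v = v and a = a and m = "b - a"] ab by (simp add: w_def)
    also have "\<dots> \<le> trace (matpow S (b - a))"
      by (rule diag_le_trace)
    also have "\<dots> \<le> Tr S"
      using ab by (intro trace_matpow_le_Tr) (auto simp: n_def)
    finally show "(\<Prod>t=a..<b. w t v) \<le> 1"
      using assms by simp
  qed
  also have "\<dots> \<le> matpow S (a + (n - b)) $ i $ j"
    by (simp add: matpow_add mat_mult_entry_le)
  \<comment> \<open>As \<open>a < b\<close>, fewer than \<open>n\<close> steps remain, which is the
    cutoff of the star.\<close>
  also have "\<dots> \<le> star S $ i $ j"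
    using ab by (intro matpow_le_star) (auto simp: n_def)
  finally show ?thesis
    using v by (simp add: n_def)
qed simp

text \<open>Multiplying the star by \<open>S\<close> gives the powers 1 to \<open>CARD('n)\<close>.
  All but the last occur in the star; the last is absorbed by \<open>matpow_card_le_star\<close>,
  which needs \<open>Tr S \<le> 1\<close>.\<close>

lemma star_vec_subinvariant:
  fixes S :: "maxplus ^ 'n ^ 'n"
  assumes "Tr S \<le> 1"
  shows "S *v (star S *v u) \<le> star S *v u"
proof -
  have "(S ** star S) $ i $ j \<le> star S $ i $ j" for i j
  proof -
    obtain l where l: "(S ** star S) $ i $ j = S $ i $ l * star S $ l $ j"
      using mat_mult_attained by blast
    obtain k where k: "k < CARD('n)" "star S $ l $ j = matpow S k $ l $ j"
      using star_attained by blast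
    have "(S ** star S) $ i $ j \<le> matpow S (Suc k) $ i $ j"
      unfolding l k(2) matpow_Suc_left by (rule mat_mult_entry_le)
    also have "\<dots> \<le> star S $ i $ j"
      using matpow_le_star[of "Suc k" S] matpow_card_le_star[OF assms] k(1)
      by (cases "Suc k = CARD('n)") (simp_all del: matpow.simps)
    finally show ?thesis .
  qed
  then have "(S ** star S) *v u \<le> star S *v u"
    by (intro mat_vec_mono) (auto simp: less_eq_vec_def)
  then show ?thesis
    by (simp add: matrix_vector_mul_assoc)
qed


section \<open>Words in two matrices\<close>

text \<open>Letter by letter, powers of \<open>B\<close> do not increase \<open>x\<close>, and each
  \<open>A\<close> costs one factor \<open>\<mu>\<close>.\<close>

lemma word_prod_vec_le:
  assumes "A *v x \<le> \<mu> *s x" "B *v x \<le> x"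
  shows "word_prod A B js *v x \<le> \<mu> ^ length js *s x"
proof (induction js)
  case (Cons i js)
  have "word_prod A B (i # js) *v x = A *v (matpow B i *v (word_prod A B js *v x))"
    by (simp add: word_prod_def matrix_vector_mul_assoc matrix_mul_assoc)
  also have "\<dots> \<le> A *v (matpow B i *v (\<mu> ^ length js *s x))"
    using Cons by (intro mat_vec_mono) auto
  also have "\<dots> = \<mu> ^ length js *s (A *v (matpow B i *v x))"
    by (simp add: mat_vec_scale)
  also have "\<dots> \<le> \<mu> ^ length js *s (A *v x)"
    using matpow_vec_le[OF assms(2)] by (intro vec_scale_mono mat_vec_mono) auto
  also have "\<dots> \<le> \<mu> ^ length js *s (\<mu> *s x)"
    using assms(1) by (rule vec_scale_mono)
  finally show ?case
    by (simp add: vector_smult_assoc mult.commute)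
qed (simp add: word_prod_def)

text \<open>The expanded power is a maximum over words of \<open>m\<close> letters, so a single word
  bounds the entry. Each letter \<open>A\<close> brings one factor \<open>c\<close>.\<close>

lemma matpow_sum_le_word:
  fixes A B :: "maxplus ^ 'n ^ 'n"
  shows "\<exists>i0 js. length js + i0 + sum_list js = m \<and>
    matpow (mat_scale c A + B) m $ i $ j
      \<le> c ^ length js * (matpow B i0 ** word_prod A B js) $ i $ j"
proof (induction m arbitrary: i)
  case 0
  then show ?case
    by (intro exI[of _ 0] exI[of _ "[]"]) (simp add: word_prod_def)
next
  case (Suc m)
  let ?S = "mat_scale c A + B"
  obtain l where l: "matpow ?S (Suc m) $ i $ j = ?S $ i $ l * matpow ?S m $ l $ j"
    using mat_mult_attained unfolding matpow_Suc_left by blast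
  obtain i0 js where w: "length js + i0 + sum_list js = m"
      "matpow ?S m $ l $ j \<le> c ^ length js * (matpow B i0 ** word_prod A B js) $ l $ j"
    using Suc by blast
  let ?W = "matpow B i0 ** word_prod A B js"
  have "matpow ?S (Suc m) $ i $ j \<le> ?S $ i $ l * (c ^ length js * ?W $ l $ j)"
    unfolding l using w(2) by (intro mp_mult_mono) auto
  moreover have "?S $ i $ l = c * A $ i $ l \<or> ?S $ i $ l = B $ i $ l"
    by (auto simp: mat_scale_def plus_maxplus_def max_def)
  ultimately consider
    (A) "matpow ?S (Suc m) $ i $ j \<le> c ^ Suc (length js) * (A $ i $ l * ?W $ l $ j)"
  | (B) "matpow ?S (Suc m) $ i $ j \<le> c ^ length js * (B $ i $ l * ?W $ l $ j)"
    by (auto simp: mult_ac)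
  then show ?case
  proof cases
    case A
    have "matpow ?S (Suc m) $ i $ j \<le> c ^ length (i0 # js) * (A ** ?W) $ i $ j"
      using A mult_left_mono[OF mat_mult_entry_le[of A i l ?W j], of "c ^ Suc (length js)"] by simp
    \<comment> \<open>After prepending \<open>A\<close>, the old leading block \<open>i0\<close>
      becomes the exponent behind the new \<open>A\<close>, and the new leading block is
      empty.\<close>
    then show ?thesis
      using w(1) by (intro exI[of _ 0] exI[of _ "i0 # js"]) (simp add: word_prod_def matrix_mul_assoc)
  next
    case B
    have "matpow ?S (Suc m) $ i $ j \<le> c ^ length js * (B ** ?W) $ i $ j"
      using B mult_left_mono[OF mat_mult_entry_le[of B i l ?W j], of "c ^ length js"] by simp
    then show ?thesis
      using w(1) by (intro exI[of _ "Suc i0"] exI[of _ js])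
        (simp add: matpow_Suc_left matrix_mul_assoc del: matpow.simps)
  qed
qed

text \<open>With \<open>k = length js\<close>, the exponent bound \<open>CARD('n) - k\<close> limits
  the letters before the last factor to \<open>CARD('n)\<close>, the count used in
  \<open>matpow_sum_le_word\<close>; \<open>k \<ge> 1\<close> becomes
  \<open>js \<noteq> []\<close>.\<close>

lemma theta_le_iff:
  fixes A B :: "maxplus ^ 'n ^ 'n"
  shows "theta A B g h \<le> c \<longleftrightarrow>
    (\<forall>i0 js. js \<noteq> [] \<longrightarrow> length js + i0 + sum_list js \<le> CARD('n) \<longrightarrow>
      trace (matpow B i0 ** word_prod A B js ** (mat 1 + col_row g (conj_transpose h) ** A))
        \<le> c ^ length js)"
    (is "?L \<longleftrightarrow> ?R")
proof -
  have "?L \<longleftrightarrow> (\<forall>k\<in>{1..CARD('n)}. \<forall>(i0, js)\<in>exponents k (CARD('n) - k).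
      trace (matpow B i0 ** word_prod A B js ** (mat 1 + col_row g (conj_transpose h) ** A))
        \<le> c ^ k)"
    unfolding theta_def
    by (simp add: mp_sum_le_iff finite_exponents case_prod_unfold mp_root_le_iff)
  also have "\<dots> \<longleftrightarrow> ?R"
    by (fastforce simp: exponents_def Suc_le_eq)
  finally show ?thesis .
qed

text \<open>With all exponents 0 and the summand \<open>mat 1\<close> of the last factor,
  \<open>theta\<close> dominates the spectral radius of \<open>A\<close>. Hence
  \<open>inverse (theta A B g h)\<close> is a true inverse.\<close>

lemma theta_neq_0:
  fixes A B :: "maxplus ^ 'n ^ 'n"
  assumes "mp_spectral_radius A \<noteq> 0"
  shows "theta A B g h \<noteq> 0"
proof
  assume "theta A B g h = 0"
  then have *: "trace (matpow B i0 ** word_prod A B js ** (mat 1 + col_row g (conj_transpose h) ** A))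
      \<le> 0 ^ length js" if "js \<noteq> []" "length js + i0 + sum_list js \<le> CARD('n)" for i0 js
    using theta_le_iff[of A B g h 0] that by auto
  have w: "word_prod A B (replicate k 0) = matpow A k" for k
    by (induction k) (simp_all add: word_prod_def matpow_Suc_left del: matpow.simps(2))
  have "trace (matpow A k) \<le> 0" if "k \<in> {1..CARD('n)}" for k
  proof -
    have "trace (matpow A k) \<le> trace (matpow A k ** (mat 1 + col_row g (conj_transpose h) ** A))"
      by (simp add: matrix_add_ldistrib trace_add mp_le_add)
    also have "\<dots> \<le> 0 ^ k"
      using *[of "replicate k 0" 0] that by (simp add: w sum_list_replicate)
    finally show ?thesis
      using that by (simp add: power_0_left)
  qed
  then have "mp_spectral_radius A \<le> 0"
    by (simp add: mp_spectral_radius_def mp_sum_le_iff mp_root_0)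
  then show False
    using assms by simp
qed


section \<open>The optimization problem\<close>

lemma theta_le_of_feasible:
  assumes "regular x" "regular h" "A *v x \<le> \<mu> *s x" "B *v x + g \<le> x" "A *v x \<le> h"
  shows "theta A B g h \<le> \<mu>"
  unfolding theta_le_iff
proof (intro allI impI)
  fix i0 js
  let ?P = "mat 1 + col_row g (conj_transpose h) ** A"
  have B: "B *v x \<le> x" and g: "g \<le> x"
    using assms(4) by (simp_all add: vec_add_le_iff)
  \<comment> \<open>\<open>A x \<le> h\<close> reads \<open>h^- A x \<le> 1\<close>, hence
    \<open>g h^- A x \<le> g \<le> x\<close>.\<close>
  have "row_col (conj_transpose h) (A *v x) \<le> 1"
    using assms(2,5) by (simp add: row_col_conj_transpose_le_iff)
  then have "row_col (conj_transpose h) (A *v x) * g $ i \<le> x $ i" for i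
    using g mp_mult_mono[of _ 1 "g $ i" "x $ i"] by (simp add: less_eq_vec_def)
  then have P: "?P *v x \<le> x"
    by (simp add: matrix_vector_mult_add_rdistrib vec_add_le_iff col_row_vec less_eq_vec_def mp_add_le_iff
        flip: matrix_vector_mul_assoc)
  have "(matpow B i0 ** word_prod A B js ** ?P) *v x
      = matpow B i0 *v (word_prod A B js *v (?P *v x))"
    by (simp add: matrix_vector_mul_assoc matrix_mul_assoc)
  also have "\<dots> \<le> matpow B i0 *v (word_prod A B js *v x)"
    using P by (intro mat_vec_mono) auto
  also have "\<dots> \<le> matpow B i0 *v (\<mu> ^ length js *s x)"
    using word_prod_vec_le[OF assms(3) B] by (intro mat_vec_mono) auto
  also have "\<dots> = \<mu> ^ length js *s (matpow B i0 *v x)"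
    by (rule mat_vec_scale)
  also have "\<dots> \<le> \<mu> ^ length js *s x"
    using matpow_vec_le[OF B] by (rule vec_scale_mono)
  finally show "trace (matpow B i0 ** word_prod A B js ** ?P) \<le> \<mu> ^ length js"
    by (rule trace_le_of_subeigenvector[OF assms(1)])
qed

text \<open>Since \<open>star B\<close> maps \<open>g\<close> below \<open>x\<close>, applying
  \<open>A\<close> ends below \<open>h\<close>. No bound on the objective enters, so the
  contrapositive gives infeasibility.\<close>

lemma Delta_le_1_of_feasible:
  assumes "regular x" "regular h" "B *v x + g \<le> x" "A *v x \<le> h"
  shows "Delta A B g h \<le> 1"
proof -
  have B: "B *v x \<le> x" and g: "g \<le> x"
    using assms(3) by (simp_all add: vec_add_le_iff)
  have "star B *v g \<le> x"
    using mat_vec_mono[OF order_refl g] star_vec_le[OF B] by (rule order_trans)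
  then have "A *v (star B *v g) \<le> A *v x"
    by (intro mat_vec_mono) auto
  then have "A *v (star B *v g) \<le> 1 *s h"
    using assms(4) by simp
  then have "row_col (conj_transpose h v* A v* star B) g \<le> 1"
    by (simp only: row_col_vec_mat row_col_conj_transpose_le_iff[OF assms(2)])
  then show ?thesis
    using Tr_le_1_of_subeigenvector[OF assms(1) B] by (simp add: Delta_def mp_add_le_iff)
qed

section \<open>Sufficiency: word bounds for \<open>S\<close>\<close>

lemma Tr_S_le_1:
  fixes A B :: "maxplus ^ 'n ^ 'n" and g h :: "maxplus ^ 'n"
  defines "S \<equiv> mat_scale (inverse (theta A B g h)) A + B"
  assumes \<theta>: "theta A B g h \<noteq> 0" and \<Delta>: "Delta A B g h \<le> 1"
  shows "Tr S \<le> 1"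
proof -
  have "matpow S m $ i $ i \<le> 1" if m: "m \<in> {1..CARD('n)}" for m i
  proof -
    obtain i0 js where w: "length js + i0 + sum_list js = m"
      and le: "matpow S m $ i $ i
        \<le> inverse (theta A B g h) ^ length js * (matpow B i0 ** word_prod A B js) $ i $ i"
      using matpow_sum_le_word unfolding S_def by blast
    let ?W = "matpow B i0 ** word_prod A B js"
    show ?thesis
    proof (cases "js = []")
      case True
      then have "matpow S m $ i $ i \<le> trace (matpow B m)"
        using le w order_trans[OF _ diag_le_trace] by (simp add: word_prod_def)
      also have "\<dots> \<le> Tr B"
        using m by (intro trace_matpow_le_Tr) auto
      finally show ?thesis
        using \<Delta> by (auto simp: Delta_def mp_add_le_iff intro: order_trans)
    next
      case False
      have "?W $ i $ i \<le> trace ?W"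
        by (rule diag_le_trace)
      \<comment> \<open>The summand \<open>mat 1\<close> of the last factor accounts for this trace;
        the other summand serves the bound on \<open>star S\<close>.\<close>
      also have "\<dots> \<le> trace (?W ** (mat 1 + col_row g (conj_transpose h) ** A))"
        by (simp add: matrix_add_ldistrib trace_add mp_le_add)
      also have "\<dots> \<le> theta A B g h ^ length js"
        using theta_le_iff[of A B g h "theta A B g h"] False w m by auto
      finally show ?thesis
        using le mp_inverse_power_mult_le[OF \<theta>] by (blast intro: order_trans)
    qed
  qed
  then show ?thesis
    by (simp add: Tr_def mp_sum_le_iff trace_le_iff)
qed

text \<open>For a word \<open>W\<close>, each term of \<open>h^- A W g\<close> is, by commutativity
  of scalars, a term of a diagonal entry of \<open>W g h^- A\<close>. Words containing
  \<open>A\<close> thus fall under \<open>theta\<close>, pure powers of \<open>B\<close> under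
  \<open>Delta\<close>.\<close>

lemma row_col_star_S_le_1:
  fixes A B :: "maxplus ^ 'n ^ 'n" and g h :: "maxplus ^ 'n"
  defines "S \<equiv> mat_scale (inverse (theta A B g h)) A + B"
  assumes \<theta>: "theta A B g h \<noteq> 0" and \<Delta>: "Delta A B g h \<le> 1"
  shows "row_col (conj_transpose h v* A v* star S) g \<le> 1"
proof -
  let ?r = "conj_transpose h v* A"
  have "?r $ i * (star S $ i $ j * g $ j) \<le> 1" for i j
  proof -
    obtain m where m: "m < CARD('n)" "star S $ i $ j = matpow S m $ i $ j"
      using star_attained by blast
    obtain i0 js where w: "length js + i0 + sum_list js = m"
      and le: "matpow S m $ i $ j
        \<le> inverse (theta A B g h) ^ length js * (matpow B i0 ** word_prod A B js) $ i $ j"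
      using matpow_sum_le_word unfolding S_def by blast
    let ?W = "matpow B i0 ** word_prod A B js"
    have le': "?r $ i * (star S $ i $ j * g $ j)
        \<le> inverse (theta A B g h) ^ length js * (?W $ i $ j * (g $ j * ?r $ i))"
      using mp_mult_mono[OF order_refl mp_mult_mono[OF le order_refl[of "g $ j"]], of "?r $ i"] m(2)
      by (simp add: mult_ac)
    show ?thesis
    proof (cases "js = []")
      case True
      have "?r $ i * (star S $ i $ j * g $ j) \<le> ?r $ i * (matpow B m $ i $ j * g $ j)"
        using le' True w by (simp add: word_prod_def mult_ac)
      \<comment> \<open>\<open>m < CARD('n)\<close> places the power inside
        \<open>star B\<close>.\<close>
      also have "\<dots> \<le> ?r $ i * (star B $ i $ j * g $ j)"
        by (intro mp_mult_mono matpow_le_star m order_refl)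
      also have "\<dots> \<le> ?r $ i * (star B *v g) $ i"
        by (intro mp_mult_mono mat_vec_entry_le order_refl)
      also have "\<dots> \<le> row_col ?r (star B *v g)"
        using row_col_le_iff[of ?r "star B *v g" "row_col ?r (star B *v g)"] by simp
      also have "\<dots> \<le> 1"
        using \<Delta> by (simp add: Delta_def mp_add_le_iff row_col_vec_mat)
      finally show ?thesis .
    next
      case False
      have G: "col_row g (conj_transpose h) ** A = col_row g ?r"
        by (simp add: vec_eq_iff matrix_matrix_mult_def col_row_def vector_matrix_mult_def
            sum_distrib_left mult_ac)
      have "?W $ i $ j * (g $ j * ?r $ i) \<le> (?W ** col_row g ?r) $ i $ i"
        using mat_mult_entry_le[of ?W i j "col_row g ?r" i] by (simp add: col_row_def)
      also have "\<dots> \<le> trace (?W ** col_row g ?r)"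
        by (rule diag_le_trace)
      also have "\<dots> \<le> trace (?W ** (mat 1 + col_row g (conj_transpose h) ** A))"
        unfolding G by (simp add: matrix_add_ldistrib trace_add mp_le_add)
      also have "\<dots> \<le> theta A B g h ^ length js"
        using theta_le_iff[of A B g h "theta A B g h"] False w m by auto
      finally show ?thesis
        using le' mp_inverse_power_mult_le[OF \<theta>] by (blast intro: order_trans)
    qed
  qed
  then have "row_col ?r (star S *v g) \<le> 1"
    unfolding row_col_le_iff matrix_vector_mult_def
    by (simp add: sum_distrib_left mp_sum_le_iff)
  then show ?thesis
    by (simp add: row_col_vec_mat)
qed

text \<open>When \<open>Tr S \<le> 1\<close>, the star maps every \<open>u\<close> to a solution of
  \<open>S x \<le> x\<close> and fixes each such solution, so a solution is its own parameter. The
  upper bound on \<open>u\<close> is \<open>A x \<le> h\<close> after residuation.\<close>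

lemma general_solution:
  fixes S :: "maxplus ^ 'n ^ 'n"
  assumes "Tr S \<le> 1" "regular h" "column_regular A"
  shows "regular x \<and> S *v x + g \<le> x \<and> A *v x \<le> h \<longleftrightarrow>
    (\<exists>u. x = star S *v u \<and> regular u \<and> g \<le> u \<and>
         u \<le> conj_transpose (conj_transpose h v* A v* star S))"
proof -
  let ?r = "conj_transpose h v* A v* star S"
  have "regular ?r"
    using assms by (intro regular_vec_mat column_regular_star regular_conj_transpose)
  then have r: "u \<le> conj_transpose ?r \<longleftrightarrow> A *v (star S *v u) \<le> h" for u
    using row_col_conj_transpose_le_iff[OF assms(2), of _ 1]
    by (simp add: le_conj_transpose_iff row_col_vec_mat)
  show ?thesis
    unfolding r
  proof (intro iffI; (elim conjE exE)?)
    assume x: "regular x" "S *v x + g \<le> x" "A *v x \<le> h"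
    then have "star S *v x = x"
      by (intro order_antisym star_vec_le star_vec_ge) (simp add: vec_add_le_iff)
    then show "\<exists>u. x = star S *v u \<and> regular u \<and> g \<le> u \<and> A *v (star S *v u) \<le> h"
      using x by (intro exI[of _ x]) (simp add: vec_add_le_iff)
  next
    fix u
    assume u: "x = star S *v u" "regular u" "g \<le> u" "A *v (star S *v u) \<le> h"
    then show "regular x \<and> S *v x + g \<le> x \<and> A *v x \<le> h"
      using star_vec_subinvariant[OF assms(1)] star_vec_ge[of u S] regular_mono
      by (auto simp: vec_add_le_iff)
  qed
qed

lemma S_vec_le_iff:
  assumes "\<mu> \<noteq> 0"
  shows "(mat_scale (inverse \<mu>) A + B) *v x + g \<le> x \<longleftrightarrow> A *v x \<le> \<mu> *s x \<and> B *v x + g \<le> x"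
proof -
  have "inverse \<mu> *s (A *v x) \<le> x \<longleftrightarrow> A *v x \<le> \<mu> *s x"
    using assms by (simp add: less_eq_vec_def mp_inverse_mult_le_iff mult.commute)
  then show ?thesis
    by (auto simp: matrix_vector_mult_add_rdistrib vec_add_le_iff mat_scale_vec)
qed

theorem theorem7:
  fixes A B :: "maxplus ^ 'n ^ 'n" and g h :: "maxplus ^ 'n"
  assumes "column_regular A"
    and "mp_spectral_radius A \<noteq> 0"
    and "regular h"
  defines "\<Delta> \<equiv> Delta A B g h"
    and "\<theta> \<equiv> theta A B g h"
  defines "S \<equiv> mat_scale (inverse \<theta>) A + B"
  shows "(\<Delta> \<le> 1 \<longrightarrow>
           (\<exists>p. feasible A B g h p \<and> objective p = \<theta>) \<and>
           (\<forall>p. feasible A B g h p \<longrightarrow> \<theta> \<le> objective p) \<and>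
           {p. is_arg_min objective (feasible A B g h) p} =
             {(star S *v u, A *v (star S *v u)) | u.
                regular u \<and> g \<le> u \<and>
                u \<le> conj_transpose (conj_transpose h v* A v* star S)}) \<and>
         (\<Delta> > 1 \<longrightarrow> \<not> (\<exists>x y. feasible A B g h (x, y)))"
proof (intro conjI[of "_ \<longrightarrow> _"] impI)
  assume "\<Delta> > 1"
  then show "\<not> (\<exists>x y. feasible A B g h (x, y))"
    using Delta_le_1_of_feasible[OF _ assms(3), of _ B g A]
    by (force simp: \<Delta>_def feasible_def)
next
  assume \<Delta>: "\<Delta> \<le> 1"
  have \<theta>0: "\<theta> \<noteq> 0"
    unfolding \<theta>_def by (rule theta_neq_0[OF assms(2)])
  have Tr: "Tr S \<le> 1"
    using Tr_S_le_1 \<theta>0 \<Delta> unfolding S_def \<theta>_def \<Delta>_def by blast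
  have lower: "\<theta> \<le> objective p" if "feasible A B g h p" for p
  proof -
    obtain x where p: "p = (x, A *v x)" and x: "regular x" "B *v x + g \<le> x" "A *v x \<le> h"
      using \<open>feasible A B g h p\<close> by (cases p) (auto simp: feasible_def)
    \<comment> \<open>The objective value itself plays the role of \<open>\<mu>\<close>.\<close>
    have "A *v x \<le> objective p *s x"
      using row_col_conj_transpose_le_iff[OF x(1), of "A *v x" "objective p"]
      by (simp add: p objective_def)
    then show ?thesis
      unfolding \<theta>_def using theta_le_of_feasible[OF x(1) assms(3)] x by blast
  qed
  have S_iff: "S *v x + g \<le> x \<longleftrightarrow> A *v x \<le> \<theta> *s x \<and> B *v x + g \<le> x" for x
    unfolding S_def by (rule S_vec_le_iff[OF \<theta>0])
  \<comment> \<open>A value at most \<open>\<theta>\<close> is a linear condition on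
    \<open>x\<close>; together with \<open>lower\<close> it means equality.\<close>
  have optimal_iff: "feasible A B g h (x, y) \<and> objective (x, y) \<le> \<theta> \<longleftrightarrow> y = A *v x \<and>
      (\<exists>u. x = star S *v u \<and> regular u \<and> g \<le> u \<and>
         u \<le> conj_transpose (conj_transpose h v* A v* star S))" for x y
    unfolding general_solution[OF Tr assms(3,1), symmetric] S_iff
    using row_col_conj_transpose_le_iff[of x "A *v x" \<theta>]
    by (auto simp: feasible_def objective_def)
  \<comment> \<open>The largest admissible parameter is the witness: it is regular, and
    \<open>g \<le> ?u\<close> amounts to \<open>h^- A (star S) g \<le> 1\<close>.\<close>
  let ?u = "conj_transpose (conj_transpose h v* A v* star S)"
  have r: "regular (conj_transpose h v* A v* star S)"
    using assms(1,3) by (intro regular_vec_mat column_regular_star regular_conj_transpose)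
  have "g \<le> ?u"
    using row_col_star_S_le_1[of A B g h] \<theta>0 \<Delta> r
    unfolding S_def \<theta>_def \<Delta>_def by (simp add: le_conj_transpose_iff)
  then have ex: "feasible A B g h (star S *v ?u, A *v (star S *v ?u)) \<and>
      objective (star S *v ?u, A *v (star S *v ?u)) \<le> \<theta>"
    unfolding optimal_iff using regular_conj_transpose[OF r] by blast
  then obtain p where p: "feasible A B g h p" "objective p = \<theta>"
    using lower order_antisym by blast
  \<comment> \<open>\<open>\<theta>\<close> is a lower bound attained at \<open>p\<close>, so
    minimizing means being feasible with value at most \<open>\<theta>\<close>.\<close>
  have "is_arg_min objective (feasible A B g h) q \<longleftrightarrow> feasible A B g h q \<and> objective q \<le> \<theta>" for q
    unfolding is_arg_min_def by (metis p lower not_less order_trans)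
  then have "{q. is_arg_min objective (feasible A B g h) q} =
      {(x, y). feasible A B g h (x, y) \<and> objective (x, y) \<le> \<theta>}"
    by auto
  also have "\<dots> = {(star S *v u, A *v (star S *v u)) | u. regular u \<and> g \<le> u \<and> u \<le> ?u}"
    unfolding optimal_iff by auto
  finally show "(\<exists>p. feasible A B g h p \<and> objective p = \<theta>) \<and>
      (\<forall>p. feasible A B g h p \<longrightarrow> \<theta> \<le> objective p) \<and>
      {p. is_arg_min objective (feasible A B g h) p} =
        {(star S *v u, A *v (star S *v u)) | u. regular u \<and> g \<le> u \<and> u \<le> ?u}"
    using p lower by blast
qed

end
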